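(* Fix an integer $k\ge 1$. For $N\ge k$ let $h_k^{(N)}=\sum_{1\le i_1<i_2<\dots<i_k\le N}\sigma_z^{i_1}\sigma_z^{i_2}\cdots\sigma_z^{i_k}$ acting on $(\mathbb{C}^2)^{\otimes N}$, and let $F_k^{\max}(N)=\max_{|\psi\rangle}4\left(\langle\psi|(h_k^{(N)})^2|\psi\rangle-\langle\psi|h_k^{(N)}|\psi\rangle^2\right)$, the maximum being over all unit vectors $|\psi\rangle\in(\mathbb{C}^2)^{\otimes N}$, be the maximum quantum Fisher information for estimating $J$ in the encoding Hamiltonian $J h_k^{(N)}$. Then $F_k^{\max}(N)$ scales as $N^{2k}$ for $N\gg k$; that is, there is a constant $c_k\in(0,\infty)$ such that $\lim_{N\to\infty}F_k^{\max}(N)/N^{2k}=c_k$.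
   Context: $\sigma_z^{i}$ denotes the Pauli operator $\sigma_z=\mathrm{diag}(1,-1)$ acting on the $i$-th tensor factor of $(\mathbb{C}^2)^{\otimes N}$ and as the identity on the others. For a pure input probe $|\psi\rangle$ and unitary encoding $e^{-iJh}$ with $h$ independent of $J$, the quantum Fisher information for $J$ equals four times the variance of $h$ in $|\psi\rangle$. *)

theory Defs
  imports Complex_Main "Jordan_Normal_Form.Matrix"
begin

(* Operators on the N-fold tensor power of C^2 are 2^N x 2^N matrices in the product basis, where the
   first tensor factor is the most significant binary digit of the basis index. *)

definition kron :: "complex mat \<Rightarrow> complex mat \<Rightarrow> complex mat" where
  "kron A B = mat (dim_row A * dim_row B) (dim_col A * dim_col B)
     (\<lambda>(r, c). A $$ (r div dim_row B, c div dim_col B) * B $$ (r mod dim_row B, c mod dim_col B))"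

definition pauli_z :: "complex mat" where
  "pauli_z = mat_of_rows_list 2 [[1, 0], [0, -1]]"

(* Tensor factors are numbered 1, ..., N. *)
definition sigma_z :: "nat \<Rightarrow> nat \<Rightarrow> complex mat" where
  "sigma_z N i = foldr kron (map (\<lambda>j. if j = i then pauli_z else 1\<^sub>m 2) [1..<Suc N]) (1\<^sub>m 1)"

definition increasing_tuples :: "nat \<Rightarrow> nat \<Rightarrow> nat list set" where
  "increasing_tuples k N = {is. length is = k \<and> sorted_wrt (<) is \<and> set is \<subseteq> {1..N}}"

definition hamiltonian :: "nat \<Rightarrow> nat \<Rightarrow> complex mat" where
  "hamiltonian k N = finsum (ring_mat TYPE(complex) (2 ^ N) ())
     (\<lambda>is. foldr (*) (map (sigma_z N) is) (1\<^sub>m (2 ^ N))) (increasing_tuples k N)"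

definition unit_vectors :: "nat \<Rightarrow> complex vec set" where
  "unit_vectors d = {\<psi> \<in> carrier_vec d. \<psi> \<bullet>c \<psi> = 1}"

(* The scalar product is conjugate-linear in its second argument. *)
definition expectation :: "complex mat \<Rightarrow> complex vec \<Rightarrow> complex" where
  "expectation A \<psi> = (A *\<^sub>v \<psi>) \<bullet>c \<psi>"

(* Quantum Fisher information of the pure probe psi under the encoding exp (- i J A); taking the real
   part loses nothing for Hermitian A. *)
definition qfi :: "complex mat \<Rightarrow> complex vec \<Rightarrow> real" where
  "qfi A \<psi> = Re (4 * (expectation (A * A) \<psi> - (expectation A \<psi>)\<^sup>2))"

(* GREATEST denotes an attained maximum, not merely a supremum. *)
definition qfi_max :: "nat \<Rightarrow> nat \<Rightarrow> real" where
  "qfi_max k N = (GREATEST F. \<exists>\<psi> \<in> unit_vectors (2 ^ N). F = qfi (hamiltonian k N) \<psi>)"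

end

theory Submission
  imports Defs
begin

text \<open>
  The Hamiltonian is diagonal in the product basis, with the elementary symmetric polynomial \<open>e\<^sub>k\<close> of
  the signs \<open>\<plusminus>1\<close> of the basis state as its eigenvalues. The variance of an observable is at most a
  quarter of the squared spectral range, attained at an equal superposition of two extreme
  eigenvectors, so the maximal quantum Fisher information is the squared spectral range. If \<open>S\<close> is
  the sum of the signs, then \<open>k! e\<^sub>k = S\<^sup>k + O(N\<^sup>k\<^sup>-\<^sup>1)\<close>, so the range is asymptotic to \<open>N\<^sup>k / k!\<close> for
  even \<open>k\<close> (where the minimum of \<open>S\<^sup>k\<close> is \<open>0\<close> or \<open>1\<close>) and to \<open>2 N\<^sup>k / k!\<close> for odd \<open>k\<close>.
\<close>

subsection \<open>Elementary symmetric polynomials\<close>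

text \<open>Indexed by the same lists as \<open>hamiltonian\<close>, so that the diagonal entries of
  the Hamiltonian take this form without reindexing.\<close>

definition elem_sym :: "(nat \<Rightarrow> real) \<Rightarrow> nat \<Rightarrow> nat \<Rightarrow> real" where
  "elem_sym s k N = (\<Sum>is\<in>increasing_tuples k N. prod_list (map s is))"

lemma finite_increasing_tuples: "finite (increasing_tuples k N)"
proof (rule finite_subset)
  show "increasing_tuples k N \<subseteq> {is. set is \<subseteq> {1..N} \<and> length is = k}"
    by (auto simp: increasing_tuples_def)
qed (rule finite_lists_length_eq, simp)

lemma increasing_tuples_0: "increasing_tuples 0 N = {[]}"
  by (auto simp: increasing_tuples_def)

lemma increasing_tuples_Suc_0: "increasing_tuples (Suc k) 0 = {}"
  by (auto simp: increasing_tuples_def)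

text \<open>In a strictly increasing list bounded by \<open>Suc N\<close>, the value
  \<open>Suc N\<close> can occur only in last place; the split is by whether it occurs.\<close>

lemma increasing_tuples_Suc_Suc:
  "increasing_tuples (Suc k) (Suc N) =
     increasing_tuples (Suc k) N \<union> (\<lambda>is. is @ [Suc N]) ` increasing_tuples k N"
proof (intro equalityI subsetI)
  fix js assume js: "js \<in> increasing_tuples (Suc k) (Suc N)"
  then have "js \<noteq> []" by (auto simp: increasing_tuples_def)
  then obtain ks j where split: "js = ks @ [j]" using rev_exhaust by blast
  have j: "j \<le> Suc N" and ij: "\<And>i. i \<in> set ks \<Longrightarrow> 1 \<le> i \<and> i < j"
    using js by (auto simp: increasing_tuples_def split sorted_wrt_append)
  then have "ks \<in> increasing_tuples k N"
    using js by (force simp: increasing_tuples_def split sorted_wrt_append)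
  moreover have "js \<in> increasing_tuples (Suc k) N" if "j \<noteq> Suc N"
    using js j ij that by (force simp: increasing_tuples_def split sorted_wrt_append)
  ultimately show "js \<in> increasing_tuples (Suc k) N \<union> (\<lambda>is. is @ [Suc N]) ` increasing_tuples k N"
    using split by blast
qed (force simp: increasing_tuples_def sorted_wrt_append)+

lemma elem_sym_0: "elem_sym s 0 N = 1"
  by (simp add: elem_sym_def increasing_tuples_0)

lemma elem_sym_Suc_0: "elem_sym s (Suc k) 0 = 0"
  by (simp add: elem_sym_def increasing_tuples_Suc_0)

text \<open>Pascal-type recursion that drives the induction on \<open>N\<close> in
  \<open>elem_sym_approx\<close>.\<close>

lemma elem_sym_Suc_Suc:
  "elem_sym s (Suc k) (Suc N) = elem_sym s (Suc k) N + s (Suc N) * elem_sym s k N"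
proof -
  have "increasing_tuples (Suc k) N \<inter> (\<lambda>is. is @ [Suc N]) ` increasing_tuples k N = {}"
    by (auto simp: increasing_tuples_def)
  then show ?thesis
    by (simp add: elem_sym_def increasing_tuples_Suc_Suc sum.union_disjoint finite_increasing_tuples
        sum.reindex inj_on_def sum_distrib_left mult.commute)
qed

section \<open>Comparison of elementary symmetric polynomials with powers of the sum\<close>

text \<open>Second-order Taylor remainder of a power, with \<open>C\<close> depending on
  \<open>k\<close> alone. Letting \<open>M\<close> bound \<open>x + s\<close> as well as
  \<open>x\<close> keeps the bound a pure multiple of \<open>M ^ k\<close> and lets the induction
  multiply by \<open>x + s\<close>.\<close>

lemma power_add_remainder_bound:
  "\<exists>C\<ge>0. \<forall>(x::real) s M. \<bar>s\<bar> \<le> 1 \<longrightarrow> \<bar>x\<bar> \<le> M \<longrightarrow> \<bar>x + s\<bar> \<le> M \<longrightarrow>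
     \<bar>(x + s) ^ (k + 2) - x ^ (k + 2) - real (k + 2) * s * x ^ (k + 1)\<bar> \<le> C * M ^ k"
proof (induction k)
  case 0
  have "\<bar>(x + s) ^ 2 - x ^ 2 - 2 * s * x\<bar> \<le> 1" if "\<bar>s\<bar> \<le> 1" for x s :: real
    using that by (simp add: power2_eq_square algebra_simps abs_square_le_1[unfolded power2_eq_square])
  then show ?case
    by (intro exI[of _ 1]) (simp add: numeral_2_eq_2)
next
  case (Suc k)
  then obtain C where C0: "C \<ge> 0" and C: "\<And>(x::real) s M. \<bar>s\<bar> \<le> 1 \<Longrightarrow> \<bar>x\<bar> \<le> M \<Longrightarrow> \<bar>x + s\<bar> \<le> M \<Longrightarrow>
     \<bar>(x + s) ^ (k + 2) - x ^ (k + 2) - real (k + 2) * s * x ^ (k + 1)\<bar> \<le> C * M ^ k"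
    by blast
  have "\<bar>(x + s) ^ (Suc k + 2) - x ^ (Suc k + 2) - real (Suc k + 2) * s * x ^ (Suc k + 1)\<bar>
      \<le> (C + real (k + 2)) * M ^ Suc k" if "\<bar>s\<bar> \<le> 1" "\<bar>x\<bar> \<le> M" "\<bar>x + s\<bar> \<le> M" for x s M :: real
  proof -
    let ?R = "(x + s) ^ (k + 2) - x ^ (k + 2) - real (k + 2) * s * x ^ (k + 1)"
    \<comment> \<open>Multiplying the expansion of (x + s)^(k+2) by x + s leaves the old remainder
      times x + s and one new term quadratic in s.\<close>
    have "(x + s) ^ (Suc k + 2) - x ^ (Suc k + 2) - real (Suc k + 2) * s * x ^ (Suc k + 1)
        = (x + s) * ?R + real (k + 2) * (s\<^sup>2 * x ^ Suc k)"
      by (simp add: algebra_simps power2_eq_square)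
    also have "\<bar>\<dots>\<bar> \<le> \<bar>x + s\<bar> * \<bar>?R\<bar> + real (k + 2) * (s\<^sup>2 * \<bar>x\<bar> ^ Suc k)"
      by (rule order_trans[OF abs_triangle_ineq]) (simp add: abs_mult power_abs)
    also have "\<dots> \<le> M * (C * M ^ k) + real (k + 2) * (1 * M ^ Suc k)"
      using that C[OF that] by (intro add_mono mult_mono power_mono) (auto simp: abs_square_le_1)
    finally show ?thesis by (simp add: algebra_simps)
  qed
  with C0 show ?case by (intro exI[of _ "C + real (k + 2)"]) auto
qed

text \<open>When a variable t is appended, j! e_j grows by j t (j-1)! e_(j-1), and S^j grows by j t
  S^(j-1) up to O(N^(j-2)), where S is the sum of the variables. By induction on the degree j the
  increments differ by O(N^(j-2)), which sums over N to O(N^(j-1)), uniformly in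
  \<open>s\<close>.\<close>

lemma elem_sym_approx:
  "\<exists>C\<ge>0. \<forall>s N. (\<forall>i. \<bar>s i\<bar> \<le> 1) \<longrightarrow>
     \<bar>fact (Suc k) * elem_sym s (Suc k) N - (\<Sum>i=1..N. s i) ^ Suc k\<bar> \<le> C * real N ^ k"
proof (induction k)
  case 0
  have "elem_sym s (Suc 0) N = (\<Sum>i=1..N. s i)" for s N
    by (induction N) (simp_all add: elem_sym_Suc_0 elem_sym_Suc_Suc elem_sym_0)
  then show ?case by (intro exI[of _ 0]) simp
next
  case (Suc k)
  then obtain C where C0: "C \<ge> 0" and C: "\<And>s N. \<forall>i. \<bar>s i\<bar> \<le> 1 \<Longrightarrow>
     \<bar>fact (Suc k) * elem_sym s (Suc k) N - (\<Sum>i=1..N. s i) ^ Suc k\<bar> \<le> C * real N ^ k"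
    by blast
  obtain D where D0: "D \<ge> 0" and D: "\<And>(x::real) s M. \<bar>s\<bar> \<le> 1 \<Longrightarrow> \<bar>x\<bar> \<le> M \<Longrightarrow> \<bar>x + s\<bar> \<le> M \<Longrightarrow>
     \<bar>(x + s) ^ (k + 2) - x ^ (k + 2) - real (k + 2) * s * x ^ (k + 1)\<bar> \<le> D * M ^ k"
    using power_add_remainder_bound by blast
  \<comment> \<open>\<open>K\<close> times (N + 1)^k bounds the growth of the error when one
    variable is added: \<open>real (k + 2) * C\<close> comes from the error one degree lower,
    \<open>D\<close> from the Taylor remainder.\<close>
  define K where "K = real (k + 2) * C + D"
  have K0: "K \<ge> 0" using C0 D0 by (simp add: K_def)
  have "\<bar>fact (Suc (Suc k)) * elem_sym s (Suc (Suc k)) N - (\<Sum>i=1..N. s i) ^ Suc (Suc k)\<bar>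
     \<le> K * real N ^ Suc k" if s: "\<forall>i. \<bar>s i\<bar> \<le> 1" for s N
  proof (induction N)
    case 0
    show ?case by (simp add: elem_sym_Suc_0)
  next
    case (Suc N)
    define x where "x = (\<Sum>i=1..N. s i)"
    define t where "t = s (Suc N)"
    define f where "f = fact (Suc (Suc k)) * elem_sym s (Suc (Suc k)) N - x ^ Suc (Suc k)"
    define g where "g = fact (Suc k) * elem_sym s (Suc k) N - x ^ Suc k"
    define r where "r = (x + t) ^ (k + 2) - x ^ (k + 2) - real (k + 2) * t * x ^ (k + 1)"
    have t: "\<bar>t\<bar> \<le> 1" using s by (simp add: t_def)
    have "\<bar>x\<bar> \<le> (\<Sum>i=1..N. \<bar>s i\<bar>)" by (simp add: x_def)
    also have "\<dots> \<le> (\<Sum>i=1..N. 1)" using s by (intro sum_mono) auto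
    finally have x: "\<bar>x\<bar> \<le> real N" by simp
    \<comment> \<open>Here M = N + 1, since |x| \<le> N and |t| \<le> 1 give |x + t| \<le> N +
      1.\<close>
    have r: "\<bar>r\<bar> \<le> D * real (Suc N) ^ k"
      unfolding r_def using t x by (intro D) auto
    have "\<bar>g\<bar> \<le> C * real N ^ k" using C[OF s] by (simp add: g_def x_def)
    also have "\<dots> \<le> C * real (Suc N) ^ k"
      using C0 by (intro mult_left_mono power_mono) auto
    finally have g: "\<bar>g\<bar> \<le> C * real (Suc N) ^ k" .
    \<comment> \<open>The main terms x^(k+2) and (k+2) t x^(k+1) cancel between the recursion and
      the Taylor expansion; only error terms remain.\<close>
    have "fact (Suc (Suc k)) * elem_sym s (Suc (Suc k)) (Suc N) - (x + t) ^ Suc (Suc k)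
        = f + real (k + 2) * (t * g) - r"
      by (simp add: elem_sym_Suc_Suc[of s "Suc k"] f_def g_def r_def t_def algebra_simps)
    also have "\<bar>\<dots>\<bar> \<le> \<bar>f\<bar> + real (k + 2) * (\<bar>t\<bar> * \<bar>g\<bar>) + \<bar>r\<bar>"
      using abs_triangle_ineq[of f "real (k + 2) * (t * g)"]
        abs_triangle_ineq4[of "f + real (k + 2) * (t * g)" r]
      by (simp add: abs_mult)
    also have "\<dots> \<le> K * real N ^ Suc k + real (k + 2) * (1 * (C * real (Suc N) ^ k)) + D * real (Suc N) ^ k"
      using Suc.IH t g r unfolding f_def x_def
      by (intro add_mono mult_mono) (auto simp del: fact_Suc)
    also have "\<dots> = K * (real N ^ Suc k + real (Suc N) ^ k)"
      by (simp add: K_def algebra_simps)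
    \<comment> \<open>One factor N is kept and the others are enlarged to N + 1, so that the sum
      collapses to (N + 1)^(k+1).\<close>
    also have "\<dots> \<le> K * (real N * real (Suc N) ^ k + real (Suc N) ^ k)"
      using K0 by (intro mult_left_mono add_right_mono) (auto intro!: mult_left_mono power_mono)
    also have "\<dots> = K * real (Suc N) ^ Suc k" by (simp add: algebra_simps)
    finally show ?case by (simp add: x_def t_def)
  qed
  with K0 show ?case by (intro exI[of _ K]) auto
qed

subsection \<open>The Hamiltonian in the product basis\<close>

text \<open>The first factor is the most significant of N binary digits, so factor i is bit N - i of
  the basis index; digit 1 belongs to the eigenvalue -1.\<close>

definition pauli_sign :: "nat \<Rightarrow> nat \<Rightarrow> nat \<Rightarrow> real" where
  "pauli_sign N r i = (if bit r (N - i) then -1 else 1)"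

lemma pauli_z_eq: "pauli_z = mat_diag 2 (\<lambda>b. if b = 1 then -1 else 1)"
proof (rule eq_matI)
  fix i j assume "i < dim_row (mat_diag 2 (\<lambda>b. if b = 1 then -1 else 1 :: complex))"
    "j < dim_col (mat_diag 2 (\<lambda>b. if b = 1 then -1 else 1 :: complex))"
  then have "i \<in> {0, 1}" "j \<in> {0, 1}" by (auto simp: mat_diag_def)
  then show "pauli_z $$ (i, j) = mat_diag 2 (\<lambda>b. if b = 1 then -1 else 1) $$ (i, j)"
    by (auto simp: pauli_z_def mat_of_rows_list_def mat_diag_def)
qed (simp_all add: pauli_z_def mat_of_rows_list_def mat_diag_def)

lemma kron_mat_diag:
  "kron (mat_diag m f) (mat_diag n g) = mat_diag (m * n) (\<lambda>r. f (r div n) * g (r mod n))"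
proof (rule eq_matI)
  fix i j assume "i < dim_row (mat_diag (m * n) (\<lambda>r. f (r div n) * g (r mod n)))"
    "j < dim_col (mat_diag (m * n) (\<lambda>r. f (r div n) * g (r mod n)))"
  then have ij: "i < m * n" "j < m * n" by (auto simp: mat_diag_def)
  then have "n > 0" by (cases n) auto
  moreover have "i div n < m" "j div n < m" using ij by (simp_all add: less_mult_imp_div_less)
  moreover have "i = j \<longleftrightarrow> i div n = j div n \<and> i mod n = j mod n"
    by (metis div_mult_mod_eq)
  ultimately show "kron (mat_diag m f) (mat_diag n g) $$ (i, j) =
      mat_diag (m * n) (\<lambda>r. f (r div n) * g (r mod n)) $$ (i, j)"
    using ij by (auto simp: kron_def mat_diag_def)
qed (simp_all add: kron_def mat_diag_def)

lemma mat_diag_cong: "(\<And>r. r < n \<Longrightarrow> f r = g r) \<Longrightarrow> mat_diag n f = mat_diag n g"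
  by (rule eq_matI) (auto simp: mat_diag_def)

lemma sigma_z_eq:
  assumes "1 \<le> i" "i \<le> N"
  shows "sigma_z N i = mat_diag (2 ^ N) (\<lambda>r. of_real (pauli_sign N r i))"
proof -
  \<comment> \<open>The induction builds the tensor product from the right: after n steps it holds
    the last n factors, numbers N + 1 - n to N. The guard \<open>Suc N - n \<le> i\<close> records
    whether factor i is already among them.\<close>
  have "foldr kron (map (\<lambda>j. if j = i then pauli_z else 1\<^sub>m 2) [Suc N - n..<Suc N]) (1\<^sub>m 1)
      = mat_diag (2 ^ n) (\<lambda>r. if Suc N - n \<le> i \<and> bit r (N - i) then -1 else 1)" if "n \<le> N" for n
    using that
  proof (induction n)
    case 0
    show ?case using assms mat_diag_one[of "Suc 0", symmetric] by (simp del: mat_diag_one)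
  next
    case (Suc n)
    have upt: "[N - n..<Suc N] = (N - n) # [Suc N - n..<Suc N]"
      using Suc.prems by (simp add: upt_conv_Cons Suc_diff_le del: upt_Suc)
    have f: "(if N - n = i then pauli_z else 1\<^sub>m 2) = mat_diag 2 (\<lambda>b. if N - n = i \<and> b = 1 then -1 else 1)"
      by (auto simp: pauli_z_eq)
    \<comment> \<open>The quotient by 2^n is the digit of the newly prepended factor N - n; the
      remainder holds the digits of the later factors.\<close>
    have entry: "(if N - n = i \<and> r div 2 ^ n = 1 then -1 else 1) *
        (if Suc N - n \<le> i \<and> bit (r mod 2 ^ n) (N - i) then -1 else 1)
        = (if N - n \<le> i \<and> bit r (N - i) then -1 else (1 :: complex))" if "r < 2 * 2 ^ n" for r :: nat
    proof -
      have "r div 2 ^ n < 2" using that by (simp add: less_mult_imp_div_less)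
      then have hd: "r div 2 ^ n = 1 \<longleftrightarrow> bit r n" by (auto simp: bit_iff_odd less_2_cases_iff)
      have tl: "bit (r mod 2 ^ n) j \<longleftrightarrow> j < n \<and> bit r j" for j
        by (simp add: bit_take_bit_iff flip: take_bit_eq_mod)
      consider "N - n = i" | "Suc N - n \<le> i" | "i < N - n" using Suc.prems by linarith
      then show ?thesis
      proof cases
        case 1
        then have "N - i = n" "\<not> Suc N - n \<le> i" "N - n \<le> i" using Suc.prems assms by linarith+
        then show ?thesis using 1 hd by simp
      next
        case 2
        then have "N - i < n" "N - n \<noteq> i" "N - n \<le> i" using Suc.prems assms by linarith+
        then show ?thesis using 2 tl[of "N - i"] by simp
      next
        case 3
        then have "\<not> Suc N - n \<le> i" using Suc.prems by linarith
        then show ?thesis using 3 by simp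
      qed
    qed
    have "n \<le> N" using Suc.prems by simp
    have diff: "Suc N - Suc n = N - n" by simp
    show ?case
      unfolding upt list.map foldr_Cons o_apply f Suc.IH[OF \<open>n \<le> N\<close>] kron_mat_diag power_Suc diff
      by (rule mat_diag_cong) (rule entry)
  qed
  from this[of N] show ?thesis
    unfolding sigma_z_def
    using assms by (auto simp: pauli_sign_def if_distrib[of complex_of_real] intro!: mat_diag_cong simp del: upt_Suc)
qed

lemma foldr_mult_mat_diag:
  assumes "\<And>i. i \<in> set is \<Longrightarrow> A i = mat_diag n (f i)"
  shows "foldr (*) (map A is) (1\<^sub>m n) = mat_diag n (\<lambda>r. prod_list (map (\<lambda>i. f i r) is))"
  using assms by (induction "is") simp_all

lemma finsum_mat_diag:
  fixes f :: "'b \<Rightarrow> nat \<Rightarrow> 'a :: comm_ring_1"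
  assumes "finite I" and "\<And>i. i \<in> I \<Longrightarrow> A i = mat_diag n (f i)"
  shows "finsum (ring_mat TYPE('a) n ()) A I = mat_diag n (\<lambda>r. \<Sum>i\<in>I. f i r)"
proof -
  interpret ring "ring_mat TYPE('a) n ()" by (rule ring_mat)
  show ?thesis
    using assms
  proof (induction I)
    case empty
    show ?case by (auto simp: ring_mat_simps mat_diag_def)
  next
    case (insert i I)
    have "A \<in> I \<rightarrow> carrier (ring_mat TYPE('a) n ())" "A i \<in> carrier (ring_mat TYPE('a) n ())"
      using insert.prems by (auto simp: ring_mat_simps)
    then have "finsum (ring_mat TYPE('a) n ()) A (insert i I)
        = mat_diag n (f i) + mat_diag n (\<lambda>r. \<Sum>i\<in>I. f i r)"
      using insert by (simp add: ring_mat_simps)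
    also have "\<dots> = mat_diag n (\<lambda>r. \<Sum>i\<in>insert i I. f i r)"
      using insert.hyps by (auto simp: mat_diag_def)
    finally show ?case .
  qed
qed

lemma hamiltonian_eq:
  "hamiltonian k N = mat_diag (2 ^ N) (\<lambda>r. of_real (elem_sym (pauli_sign N r) k N))"
proof -
  have prod: "foldr (*) (map (sigma_z N) is) (1\<^sub>m (2 ^ N))
      = mat_diag (2 ^ N) (\<lambda>r. of_real (prod_list (map (pauli_sign N r) is)))"
    if "is \<in> increasing_tuples k N" for "is"
  proof -
    have "of_real (prod_list (map g js)) = (prod_list (map (\<lambda>i. of_real (g i)) js) :: complex)"
      for g :: "nat \<Rightarrow> real" and js
      by (induction js) simp_all
    moreover have "foldr (*) (map (sigma_z N) is) (1\<^sub>m (2 ^ N))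
      = mat_diag (2 ^ N) (\<lambda>r. prod_list (map (\<lambda>i. of_real (pauli_sign N r i)) is))"
      using that by (intro foldr_mult_mat_diag sigma_z_eq) (auto simp: increasing_tuples_def)
    ultimately show ?thesis by simp
  qed
  show ?thesis
    unfolding hamiltonian_def elem_sym_def of_real_sum
    by (rule finsum_mat_diag[OF finite_increasing_tuples prod])
qed

subsection \<open>Maximal variance of a diagonal observable\<close>

text \<open>Only the probabilities of the basis states enter, so the variance of a diagonal
  observable becomes that of a classical random variable.\<close>

lemma expectation_mat_diag:
  assumes "\<psi> \<in> carrier_vec d"
  shows "expectation (mat_diag d (\<lambda>r. of_real (a r))) \<psi> = of_real (\<Sum>r<d. a r * (cmod (\<psi> $ r))\<^sup>2)"
proof -
  have "mat_diag d (\<lambda>r. of_real (a r)) *\<^sub>v \<psi> = vec d (\<lambda>r. of_real (a r) * \<psi> $ r)"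
  proof (rule eq_vecI)
    fix i assume "i < dim_vec (vec d (\<lambda>r. of_real (a r) * \<psi> $ r))"
    then show "(mat_diag d (\<lambda>r. of_real (a r)) *\<^sub>v \<psi>) $ i = vec d (\<lambda>r. of_real (a r) * \<psi> $ r) $ i"
      using assms by (simp add: mat_diag_def scalar_prod_def if_distrib[of "\<lambda>x. x * _"] cong: if_cong)
  qed (simp add: mat_diag_def)
  then have "expectation (mat_diag d (\<lambda>r. of_real (a r))) \<psi>
      = (\<Sum>r<d. of_real (a r) * \<psi> $ r * cnj (\<psi> $ r))"
    using assms by (simp add: expectation_def scalar_prod_def lessThan_atLeast0)
  then show ?thesis
    by (simp add: mult.assoc complex_norm_square[symmetric])
qed

lemma unit_vectors_eq:
  "\<psi> \<in> unit_vectors d \<longleftrightarrow> \<psi> \<in> carrier_vec d \<and> (\<Sum>r<d. (cmod (\<psi> $ r))\<^sup>2) = 1"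
proof (cases "\<psi> \<in> carrier_vec d")
  case True
  \<comment> \<open>The squared norm is the expectation of the identity, the diagonal matrix with
    entries 1.\<close>
  have "\<psi> \<bullet>c \<psi> = expectation (mat_diag d (\<lambda>r. of_real 1)) \<psi>"
    using True by (simp add: expectation_def)
  also have "\<dots> = of_real (\<Sum>r<d. (cmod (\<psi> $ r))\<^sup>2)"
    using expectation_mat_diag[OF True, of "\<lambda>_. 1"] by simp
  finally show ?thesis using True by (simp only: unit_vectors_def mem_Collect_eq of_real_eq_1_iff)
qed (simp add: unit_vectors_def)

lemma qfi_mat_diag:
  assumes "\<psi> \<in> carrier_vec d"
  shows "qfi (mat_diag d (\<lambda>r. of_real (a r))) \<psi>
    = 4 * ((\<Sum>r<d. (a r)\<^sup>2 * (cmod (\<psi> $ r))\<^sup>2) - (\<Sum>r<d. a r * (cmod (\<psi> $ r))\<^sup>2)\<^sup>2)"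
proof -
  have sq: "mat_diag d (\<lambda>r. of_real (a r)) * mat_diag d (\<lambda>r. of_real (a r))
    = mat_diag d (\<lambda>r. complex_of_real ((a r)\<^sup>2))"
    by (simp add: power2_eq_square)
  show ?thesis
    unfolding qfi_def sq expectation_mat_diag[OF assms] by (simp flip: of_real_power of_real_diff)
qed

text \<open>Popoviciu's inequality. Averaging (M - a)(a - m) \<ge> 0 bounds the variance by (M -
  \<mu>)(\<mu> - m), and four times this is (M - m)^2 - (M + m - 2 \<mu>)^2.\<close>

lemma qfi_mat_diag_le:
  assumes \<psi>: "\<psi> \<in> unit_vectors d" and bounds: "\<And>r. r < d \<Longrightarrow> m \<le> a r \<and> a r \<le> M"
  shows "qfi (mat_diag d (\<lambda>r. of_real (a r))) \<psi> \<le> (M - m)\<^sup>2"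
proof -
  define p where "p r = (cmod (\<psi> $ r))\<^sup>2" for r
  define \<mu> where "\<mu> = (\<Sum>r<d. a r * p r)"
  have p: "(\<Sum>r<d. p r) = 1" and carrier: "\<psi> \<in> carrier_vec d"
    using \<psi> by (simp_all add: unit_vectors_eq p_def)
  have "0 \<le> (\<Sum>r<d. (M - a r) * (a r - m) * p r)"
    using bounds by (intro sum_nonneg mult_nonneg_nonneg) (auto simp: p_def)
  also have "\<dots> = (\<Sum>r<d. (M + m) * (a r * p r) - M * m * p r - (a r)\<^sup>2 * p r)"
    by (simp add: algebra_simps power2_eq_square)
  also have "\<dots> = (M + m) * \<mu> - M * m - (\<Sum>r<d. (a r)\<^sup>2 * p r)"
    by (simp add: sum_subtractf \<mu>_def p flip: sum_distrib_left)
  finally have "4 * ((\<Sum>r<d. (a r)\<^sup>2 * p r) - \<mu>\<^sup>2) \<le> (M - m)\<^sup>2 - (M + m - 2 * \<mu>)\<^sup>2"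
    by (simp add: algebra_simps power2_eq_square)
  also have "\<dots> \<le> (M - m)\<^sup>2" by simp
  finally show ?thesis by (simp add: qfi_mat_diag[OF carrier] p_def \<mu>_def)
qed

lemma qfi_mat_diag_attained:
  assumes "R < d" "Q < d"
  shows "\<exists>\<psi>\<in>unit_vectors d. qfi (mat_diag d (\<lambda>r. of_real (a r))) \<psi> = (a R - a Q)\<^sup>2"
proof -
  \<comment> \<open>Two indicators are added so that the case R = Q is covered: they then put mass 1
    on one index, and both sides of the claim are 0.\<close>
  define p :: "nat \<Rightarrow> real" where "p r = (if r = R then 1 / 2 else 0) + (if r = Q then 1 / 2 else 0)" for r
  define \<psi> where "\<psi> = vec d (\<lambda>r. complex_of_real (sqrt (p r)))"
  have carrier: "\<psi> \<in> carrier_vec d" by (simp add: \<psi>_def)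
  have "(cmod (\<psi> $ r))\<^sup>2 = p r" if "r < d" for r
    using that by (simp add: \<psi>_def p_def)
  then have mean: "(\<Sum>r<d. f r * (cmod (\<psi> $ r))\<^sup>2) = (f R + f Q) / 2" for f
    using assms by (simp add: p_def ring_distribs sum.distrib if_distrib[of "\<lambda>x. _ * x"] add_divide_distrib cong: if_cong)
  have "\<psi> \<in> unit_vectors d"
    using mean[of "\<lambda>_. 1"] carrier by (simp add: unit_vectors_eq)
  moreover have "qfi (mat_diag d (\<lambda>r. of_real (a r))) \<psi> = (a R - a Q)\<^sup>2"
    unfolding qfi_mat_diag[OF carrier] mean by (simp add: field_simps power2_eq_square)
  ultimately show ?thesis by blast
qed

text \<open>With \<open>R\<close> and \<open>Q\<close> at the extreme eigenvalues the upper bound is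
  attained, which is what identifies a \<open>GREATEST\<close>.\<close>

lemma qfi_max_eq:
  assumes "R < 2 ^ N" "Q < 2 ^ N"
    and "\<And>r. r < 2 ^ N \<Longrightarrow> elem_sym (pauli_sign N Q) k N \<le> elem_sym (pauli_sign N r) k N \<and>
       elem_sym (pauli_sign N r) k N \<le> elem_sym (pauli_sign N R) k N"
  shows "qfi_max k N = (elem_sym (pauli_sign N R) k N - elem_sym (pauli_sign N Q) k N)\<^sup>2"
  unfolding qfi_max_def hamiltonian_eq
proof (rule Greatest_equality)
  show "\<exists>\<psi>\<in>unit_vectors (2 ^ N). (elem_sym (pauli_sign N R) k N - elem_sym (pauli_sign N Q) k N)\<^sup>2
      = qfi (mat_diag (2 ^ N) (\<lambda>r. of_real (elem_sym (pauli_sign N r) k N))) \<psi>"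
    using qfi_mat_diag_attained[OF assms(1,2)] by metis
qed (use qfi_mat_diag_le[OF _ assms(3)] in auto)

subsection \<open>The spectral range\<close>

text \<open>In the basis state with index \<^term>\<open>mask m\<close> exactly the last \<open>m\<close> factors have sign \<open>-1\<close>.\<close>

lemma sum_pauli_sign_mask:
  assumes "m \<le> N"
  shows "(\<Sum>i=1..N. pauli_sign N (mask m) i) = real N - 2 * real m"
proof -
  have "(\<Sum>i=1..N. pauli_sign N (mask m) i) = (\<Sum>j<N. if j < m then -1 else 1)"
    by (rule sum.reindex_bij_witness[of _ "\<lambda>j. N - j" "\<lambda>i. N - i"])
       (auto simp: pauli_sign_def bit_mask_iff)
  also have "\<dots> = (\<Sum>j<N. 1) - (\<Sum>j<N. if j < m then 2 else 0)"
    by (subst sum_subtractf[symmetric]) (auto intro: sum.cong)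
  also have "(\<Sum>j<N. if j < m then 2 else 0) = (\<Sum>j<m. 2 :: real)"
    using assms by (intro sum.mono_neutral_cong_right) auto
  finally show ?thesis by simp
qed

lemma abs_sum_pauli_sign_le: "\<bar>\<Sum>i=1..N. pauli_sign N r i\<bar> \<le> real N"
proof -
  have "\<bar>\<Sum>i=1..N. pauli_sign N r i\<bar> \<le> (\<Sum>i=1..N. \<bar>pauli_sign N r i\<bar>)" by simp
  also have "\<dots> = real N" by (simp add: pauli_sign_def if_distrib[of abs] cong: if_cong)
  finally show ?thesis .
qed

text \<open>The witness for \<open>D\<close> is the spectral range. An error one power of
  \<open>N\<close> below the main term suffices for the limit.\<close>

lemma sqrt_qfi_max_bounds:
  obtains D C where "C \<ge> 0"
    and "\<And>N. N \<ge> 1 \<Longrightarrow> qfi_max (Suc k) N = (D N)\<^sup>2"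
    and "\<And>N. N \<ge> 1 \<Longrightarrow>
      \<bar>fact (Suc k) * D N - (if even (Suc k) then 1 else 2) * real N ^ Suc k\<bar> \<le> C * real N ^ k"
proof -
  obtain C where C0: "C \<ge> 0" and C: "\<And>s N. \<forall>i. \<bar>s i\<bar> \<le> 1 \<Longrightarrow>
     \<bar>fact (Suc k) * elem_sym s (Suc k) N - (\<Sum>i=1..N. s i) ^ Suc k\<bar> \<le> C * real N ^ k"
    using elem_sym_approx[of k] by blast
  define e where "e N r = elem_sym (pauli_sign N r) (Suc k) N" for N r
  define S where "S N r = (\<Sum>i=1..N. pauli_sign N r i)" for N r
  have approx: "\<bar>fact (Suc k) * e N r - S N r ^ Suc k\<bar> \<le> C * real N ^ k" for N r
    unfolding e_def S_def by (rule C) (simp add: pauli_sign_def)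
  define D where "D N = Max (e N ` {..<2 ^ N}) - Min (e N ` {..<2 ^ N})" for N
  \<comment> \<open>Each of the two extreme eigenvalues contributes one \<open>C\<close>; the extra
    1 absorbs the least value of the power of the sign sum, which is 1 for an even exponent and odd
    N.\<close>
  have *: "qfi_max (Suc k) N = (D N)\<^sup>2 \<and>
      \<bar>fact (Suc k) * D N - (if even (Suc k) then 1 else 2) * real N ^ Suc k\<bar> \<le> (2 * C + 1) * real N ^ k"
    if N: "N \<ge> 1" for N
  proof -
    have ne: "e N ` {..<2 ^ N} \<noteq> {}" and fin: "finite (e N ` {..<2 ^ N})" by (auto simp: lessThan_empty_iff)
    obtain R where R: "R < 2 ^ N" "Max (e N ` {..<2 ^ N}) = e N R"
      using Max_in[OF fin ne] by auto
    obtain Q where Q: "Q < 2 ^ N" "Min (e N ` {..<2 ^ N}) = e N Q"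
      using Min_in[OF fin ne] by auto
    have D: "D N = e N R - e N Q" by (simp add: D_def R Q)
    have max: "e N r \<le> e N R" if "r < 2 ^ N" for r
      using Max_ge[OF fin, of "e N r"] that R(2) by simp
    have min: "e N Q \<le> e N r" if "r < 2 ^ N" for r
      using Min_le[OF fin, of "e N r"] that Q(2) by simp
    have "qfi_max (Suc k) N = (D N)\<^sup>2"
      unfolding D e_def by (rule qfi_max_eq) (use R Q max min in \<open>auto simp: e_def\<close>)
    moreover
    \<comment> \<open>Basis states with exactly m signs -1 serve as test states: the smallest
      eigenvalue is at most theirs, the largest at least theirs.\<close>
    have mask: "fact (Suc k) * e N Q - C * real N ^ k \<le> (real N - 2 * real m) ^ Suc k"
      "(real N - 2 * real m) ^ Suc k \<le> fact (Suc k) * e N R + C * real N ^ k" if "m \<le> N" for m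
    proof -
      have "mask m < (2 ^ N :: nat)"
        using power_increasing[OF that, of "2 :: nat"] zero_less_power[of "2 :: nat" m]
        unfolding mask_eq_exp_minus_1 by linarith
      then have "fact (Suc k) * e N Q \<le> fact (Suc k) * e N (mask m)"
        "fact (Suc k) * e N (mask m) \<le> fact (Suc k) * e N R"
        by (auto intro!: mult_left_mono max min simp del: fact_Suc)
      then show "fact (Suc k) * e N Q - C * real N ^ k \<le> (real N - 2 * real m) ^ Suc k"
        "(real N - 2 * real m) ^ Suc k \<le> fact (Suc k) * e N R + C * real N ^ k"
        using approx[of N "mask m"] unfolding S_def sum_pauli_sign_mask[OF that] by linarith+
    qed
    have S: "\<bar>S N r ^ Suc k\<bar> \<le> real N ^ Suc k" for r
      unfolding S_def power_abs by (intro power_mono abs_sum_pauli_sign_le) simp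
    have R_ge: "real N ^ Suc k \<le> fact (Suc k) * e N R + C * real N ^ k"
      using mask(2)[of 0] by simp
    have R_le: "fact (Suc k) * e N R \<le> real N ^ Suc k + C * real N ^ k"
      using approx[of N R] S[of R] by linarith
    have N1: "1 \<le> real N ^ k" using N by simp
    have "\<bar>fact (Suc k) * (e N R - e N Q) - (if even (Suc k) then 1 else 2) * real N ^ Suc k\<bar>
        \<le> 2 * (C * real N ^ k) + real N ^ k"
    proof (cases "even (Suc k)")
      case True
      \<comment> \<open>Half of the factors, rounded down, get sign -1, so the sum of the signs is 0
        or 1 according to the parity of N.\<close>
      have "real N - 2 * real (N div 2) \<in> {0, 1}" by (cases "even N") (auto elim!: evenE oddE)
      then have "(real N - 2 * real (N div 2)) ^ Suc k \<le> 1" by auto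
      then have "fact (Suc k) * e N Q \<le> 1 + C * real N ^ k"
        using mask(1)[of "N div 2"] by linarith
      moreover have "- (C * real N ^ k) \<le> fact (Suc k) * e N Q"
        using approx[of N Q] zero_le_even_power[OF True, of "S N Q"] by linarith
      ultimately show ?thesis
        using R_ge R_le N1 True unfolding right_diff_distrib by (simp add: abs_le_iff del: fact_Suc power_Suc)
    next
      case False
      \<comment> \<open>With all signs negative (m = N) the sum is -N, whose odd power is the least
        possible.\<close>
      have "(real N - 2 * real N) ^ Suc k = - (real N ^ Suc k)"
        using False power_minus_odd[of "Suc k" "real N"] by simp
      then have "fact (Suc k) * e N Q \<le> - (real N ^ Suc k) + C * real N ^ k"
        using mask(1)[of N] by linarith
      moreover have "- (real N ^ Suc k) - C * real N ^ k \<le> fact (Suc k) * e N Q"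
        using approx[of N Q] S[of Q] by linarith
      ultimately show ?thesis
        using R_ge R_le N1 False unfolding right_diff_distrib by (simp add: abs_le_iff del: fact_Suc power_Suc)
    qed
    then have "\<bar>fact (Suc k) * D N - (if even (Suc k) then 1 else 2) * real N ^ Suc k\<bar> \<le> (2 * C + 1) * real N ^ k"
      unfolding D by (simp add: algebra_simps del: fact_Suc power_Suc)
    ultimately show ?thesis by blast
  qed
  show thesis
    by (rule that[of "2 * C + 1" D]) (use C0 * in auto)
qed

section \<open>Passage to the limit\<close>

theorem theorem1:
  fixes k :: nat
  assumes "k \<ge> 1"
  shows "\<exists>c::real. c > 0 \<and> (\<lambda>N. qfi_max k N / real N ^ (2 * k)) \<longlonglongrightarrow> c"
proof -
  obtain n where n: "k = Suc n" using assms by (cases k) auto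
  \<comment> \<open>The leading coefficient of k! times the spectral range.\<close>
  define b :: real where "b = (if even k then 1 else 2)"
  obtain D C where "C \<ge> 0"
    and qfi: "\<And>N. N \<ge> 1 \<Longrightarrow> qfi_max k N = (D N)\<^sup>2"
    and D: "\<And>N. N \<ge> 1 \<Longrightarrow> \<bar>fact k * D N - b * real N ^ k\<bar> \<le> C * real N ^ n"
    using sqrt_qfi_max_bounds[of n thesis] unfolding n b_def by blast
  \<comment> \<open>Dividing the error bound by N^k leaves C / N, since k = n + 1.\<close>
  have "(\<lambda>N. fact k * (D N / real N ^ k) - b) \<longlonglongrightarrow> 0"
  proof (rule tendsto_rabs_zero_cancel, rule tendsto_sandwich[of "\<lambda>_. 0" _ _ "\<lambda>N. C / real N"])
    show "\<forall>\<^sub>F N in sequentially. \<bar>fact k * (D N / real N ^ k) - b\<bar> \<le> C / real N"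
    proof (rule eventually_sequentiallyI)
      fix N :: nat assume N: "1 \<le> N"
      then have "fact k * (D N / real N ^ k) - b = (fact k * D N - b * real N ^ k) / real N ^ k"
        by (simp add: diff_divide_distrib)
      then have "\<bar>fact k * (D N / real N ^ k) - b\<bar> = \<bar>fact k * D N - b * real N ^ k\<bar> / real N ^ k"
        by (simp only: abs_divide power_abs abs_of_nat)
      also have "\<dots> \<le> C * real N ^ n / real N ^ k"
        using D[OF N] by (intro divide_right_mono) auto
      also have "\<dots> = C / real N" using N by (simp add: n)
      finally show "\<bar>fact k * (D N / real N ^ k) - b\<bar> \<le> C / real N" .
    qed
    show "(\<lambda>N. C / real N) \<longlonglongrightarrow> 0" by (rule lim_const_over_n)
  qed auto
  then have "(\<lambda>N. fact k * (D N / real N ^ k)) \<longlonglongrightarrow> b"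
    by (simp add: LIM_zero_iff)
  \<comment> \<open>The factorial cancels inside the square, so the limit constant is 1 / (k!)^2 for
    even k and 4 / (k!)^2 for odd k.\<close>
  then have "(\<lambda>N. (fact k * (D N / real N ^ k) / fact k)\<^sup>2) \<longlonglongrightarrow> (b / fact k)\<^sup>2"
    by (intro tendsto_intros) auto
  moreover have "\<forall>\<^sub>F N in sequentially.
      (fact k * (D N / real N ^ k) / fact k)\<^sup>2 = qfi_max k N / real N ^ (2 * k)"
    by (rule eventually_sequentiallyI[of 1]) (simp add: qfi power_divide mult.commute flip: power_mult)
  ultimately have "(\<lambda>N. qfi_max k N / real N ^ (2 * k)) \<longlonglongrightarrow> (b / fact k)\<^sup>2"
    by (blast intro: Lim_transform_eventually)
  moreover have "(b / fact k)\<^sup>2 > 0" by (simp add: b_def)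
  ultimately show ?thesis by blast
qed

end
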